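(* Let $G$ be an $\alpha$-weakly-Helly graph. For every $M\subseteq V(G)$, $G$ has a spanning tree $T$ such that for all $x\in V(G)$, $$e_T^M(x)-e_G^M(x)\le\lceil diam_G(C_G^{\alpha}(M))/2\rceil+3\alpha.$$
   Context: All graphs are finite, simple, undirected, unweighted and connected. A graph $G$ is $\alpha$-weakly-Helly if for every family of pairwise intersecting disks $\{D_G(v,r(v)) : v\in S\}$ (where $D_G(v,r)=\{u: d_G(u,v)\le r\}$) the disks $D_G(v,r(v)+\alpha)$, $v\in S$, have a common vertex. For a graph $X$ on vertex set containing $M$ and $v\in V(X)$: $e_X^M(v)=\max_{u\in M}d_X(v,u)$. Further $rad_G(M)=\min_{v\in V(G)}e_G^M(v)$, $C_G^{\ell}(M)=\{v: e_G^M(v)\le rad_G(M)+\ell\}$, and $diam_G(S)=\max_{u,v\in S}d_G(u,v)$. *)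

theory Defs
  imports "Graph_Theory.Graph_Theory"
begin

text \<open>
  Finite simple undirected graphs are the locale \<open>graph\<close>: finite, loop-free, without parallel
  arcs, every edge represented by its two opposite arcs. \<open>Digraph_Component.connected\<close> includes
  nonemptiness of the vertex set.
\<close>

(* The value is meaningful only if v is reachable from u. *)
definition gdist :: "('a, 'b) pre_digraph \<Rightarrow> 'a \<Rightarrow> 'a \<Rightarrow> nat" where
  "gdist G u v = (LEAST n. \<exists>p. pre_digraph.awalk G u p v \<and> length p = n)"

definition disk :: "('a, 'b) pre_digraph \<Rightarrow> 'a \<Rightarrow> nat \<Rightarrow> 'a set" where
  "disk G v r = {u \<in> verts G. gdist G u v \<le> r}"

definition weakly_Helly :: "nat \<Rightarrow> ('a, 'b) pre_digraph \<Rightarrow> bool" where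
  "weakly_Helly \<alpha> G \<longleftrightarrow>
    (\<forall>S r. S \<subseteq> verts G \<longrightarrow>
      (\<forall>u \<in> S. \<forall>v \<in> S. disk G u (r u) \<inter> disk G v (r v) \<noteq> {}) \<longrightarrow>
      (\<exists>c \<in> verts G. \<forall>v \<in> S. c \<in> disk G v (r v + \<alpha>)))"

(* On nat, SUP of a finite nonempty family is its maximum, and SUP of the empty family is 0;
   this fixes the value for M = {}. *)
definition ecc :: "('a, 'b) pre_digraph \<Rightarrow> 'a set \<Rightarrow> 'a \<Rightarrow> nat" where
  "ecc G M v = (SUP u \<in> M. gdist G v u)"

definition rad :: "('a, 'b) pre_digraph \<Rightarrow> 'a set \<Rightarrow> nat" where
  "rad G M = (MIN v \<in> verts G. ecc G M v)"

definition center :: "('a, 'b) pre_digraph \<Rightarrow> nat \<Rightarrow> 'a set \<Rightarrow> 'a set" where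
  "center G l M = {v \<in> verts G. ecc G M v \<le> rad G M + l}"

definition diam :: "('a, 'b) pre_digraph \<Rightarrow> 'a set \<Rightarrow> nat" where
  "diam G S = (SUP (u, v) \<in> S \<times> S. gdist G u v)"

text \<open>
  The library's \<open>forest\<close>, \<open>tree\<close> and \<open>spanning_tree\<close> forbid only directed cycles, and count an arc
  followed by its opposite as a cycle, so no symmetric digraph with an edge satisfies them.
  A cycle of an undirected graph is a \<open>cycle\<close> of its symmetric digraph of length at least 3.
\<close>

definition undirected_tree :: "('a, 'b) pre_digraph \<Rightarrow> bool" where
  "undirected_tree T \<longleftrightarrow>
    graph T \<and> Digraph_Component.connected T \<and>
    \<not> (\<exists>p. pre_digraph.cycle T p \<and> length p \<ge> 3)"

definition undirected_spanning_tree ::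
    "('a, 'b) pre_digraph \<Rightarrow> ('a, 'b) pre_digraph \<Rightarrow> bool" where
  "undirected_spanning_tree T G \<longleftrightarrow> undirected_tree T \<and> spanning T G"

end

theory Submission
  imports Defs
begin

text \<open>
  Let \<open>r = rad G M\<close>, \<open>C = center G \<alpha> M\<close> and \<open>h = \<lceil>diam G C / 2\<rceil>\<close>. The disks of radius \<open>r\<close> around
  \<open>M\<close> meet each other, and each of them meets the disk of radius \<open>ecc G M x - r\<close> around \<open>x\<close>;
  the Helly property puts \<open>x\<close> at distance at most \<open>ecc G M x - r + \<alpha>\<close> from \<open>C\<close>.
  If \<open>h \<ge> \<alpha>\<close>, the disks of radius \<open>r\<close> around \<open>M\<close> and of radius \<open>h\<close> around \<open>C\<close> all meet
  each other, so some vertex \<open>c \<in> C\<close> is within \<open>h + \<alpha>\<close> of all of \<open>C\<close>; if \<open>h < \<alpha>\<close>, any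
  \<open>c\<close> with \<open>ecc G M c = r\<close> is. A breadth-first search tree rooted at \<open>c\<close> works, since its
  eccentricities are at most \<open>gdist G x c + ecc G M c\<close>.
\<close>

section \<open>Distances\<close>

lemma gdist_le_length: "pre_digraph.awalk G u p v \<Longrightarrow> gdist G u v \<le> length p"
  unfolding gdist_def by (rule Least_le) blast

lemma (in wf_digraph) shortest_awalk:
  assumes "u \<rightarrow>\<^sup>* v"
  obtains p where "awalk u p v" "length p = gdist G u v"
proof -
  have "\<exists>n p. awalk u p v \<and> length p = n"
    using assms by (simp add: reachable_awalk)
  then have "\<exists>p. awalk u p v \<and> length p = gdist G u v"
    unfolding gdist_def by (rule LeastI_ex)
  then show ?thesis using that by blast
qed

lemma (in wf_digraph) gdist_refl: "u \<in> verts G \<Longrightarrow> gdist G u u = 0"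
  using gdist_le_length[of G u "[]" u] by (simp add: awalk_Nil_iff)

lemma (in wf_digraph) gdist_triangle:
  assumes "u \<rightarrow>\<^sup>* v" "v \<rightarrow>\<^sup>* w"
  shows "gdist G u w \<le> gdist G u v + gdist G v w"
proof -
  obtain p where p: "awalk u p v" "length p = gdist G u v"
    using assms(1) by (rule shortest_awalk)
  obtain q where q: "awalk v q w" "length q = gdist G v w"
    using assms(2) by (rule shortest_awalk)
  show ?thesis
    using gdist_le_length[OF awalk_appendI[OF p(1) q(1)]] p(2) q(2) by simp
qed

lemma (in sym_digraph) awalk_reverse:
  assumes "awalk u p v"
  shows "\<exists>q. awalk v q u \<and> length q = length p"
  using assms
proof (induction p arbitrary: u)
  case Nil
  then show ?case by (auto simp: awalk_Nil_iff)
next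
  case (Cons e p)
  then have e: "e \<in> arcs G" "tail G e = u" and p: "awalk (head G e) p v"
    by (auto simp: awalk_Cons_iff)
  obtain q where q: "awalk v q (head G e)" "length q = length p"
    using Cons.IH[OF p] by blast
  obtain e' where e': "e' \<in> arcs G" "tail G e' = head G e" "head G e' = u"
    using sym_arcs e unfolding symmetric_conv by metis
  then have "awalk (head G e) [e'] u"
    by (auto simp: awalk_simps)
  with q(1) have "awalk v (q @ [e']) u"
    by (rule awalk_appendI)
  moreover have "length (q @ [e']) = length (e # p)"
    using q(2) by simp
  ultimately show ?case by blast
qed

lemma (in sym_digraph) gdist_commute:
  assumes "u \<rightarrow>\<^sup>* v"
  shows "gdist G u v = gdist G v u"
proof -
  have le: "gdist G b a \<le> gdist G a b" if ab: "a \<rightarrow>\<^sup>* b" for a b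
  proof -
    obtain p where p: "awalk a p b" "length p = gdist G a b"
      using ab by (rule shortest_awalk)
    obtain q where q: "awalk b q a" "length q = length p"
      using awalk_reverse[OF p(1)] by blast
    show ?thesis
      using gdist_le_length[OF q(1)] p(2) q(2) by simp
  qed
  show ?thesis
    using le[OF assms] le[OF symmetric_reachable'[OF assms]] by simp
qed

text \<open>Cut a shortest walk after \<open>a\<close> arcs; if it is shorter than that, the cut
  point is \<open>v\<close> itself. This is what turns a bound on a distance into a meeting of two
  disks.\<close>

lemma (in wf_digraph) ex_intermediate_vertex:
  assumes "u \<rightarrow>\<^sup>* v" "gdist G u v \<le> a + b"
  obtains w where "w \<in> verts G" "u \<rightarrow>\<^sup>* w" "w \<rightarrow>\<^sup>* v" "gdist G u w \<le> a" "gdist G w v \<le> b"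
proof -
  obtain p where p: "awalk u p v" "length p = gdist G u v"
    using assms(1) by (rule shortest_awalk)
  then have "awalk u (take a p @ drop a p) v"
    by simp
  then obtain w where w: "awalk u (take a p) w" "awalk w (drop a p) v"
    unfolding awalk_append_iff by blast
  show ?thesis
  proof
    show "gdist G u w \<le> a"
      using gdist_le_length[OF w(1)] by simp
    show "gdist G w v \<le> b"
      using gdist_le_length[OF w(2)] p assms by simp
    show "w \<in> verts G"
      using w(1) by (rule awalk_last_in_verts)
    show "u \<rightarrow>\<^sup>* w" "w \<rightarrow>\<^sup>* v"
      using w by (auto intro: reachable_awalkI)
  qed
qed

locale connected_graph = graph +
  assumes connected: "Digraph_Component.connected G"
begin

lemma reachable: "u \<in> verts G \<Longrightarrow> v \<in> verts G \<Longrightarrow> u \<rightarrow>\<^sup>* v"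
  using connected sym_arcs
  by (auto simp: connected_def strongly_connected_def reachable_mk_symmetric_eq)

lemma verts_nonempty: "verts G \<noteq> {}"
  using connected by (auto simp: connected_def strongly_connected_def)

lemma dist_triangle:
  "u \<in> verts G \<Longrightarrow> v \<in> verts G \<Longrightarrow> w \<in> verts G \<Longrightarrow> gdist G u w \<le> gdist G u v + gdist G v w"
  by (simp add: gdist_triangle reachable)

lemma dist_commute: "u \<in> verts G \<Longrightarrow> v \<in> verts G \<Longrightarrow> gdist G u v = gdist G v u"
  by (simp add: gdist_commute reachable)

lemma disks_intersect:
  assumes "u \<in> verts G" "v \<in> verts G" "gdist G u v \<le> a + b"
  shows "disk G u a \<inter> disk G v b \<noteq> {}"
proof -
  obtain w where "w \<in> verts G" "gdist G u w \<le> a" "gdist G w v \<le> b"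
    using reachable[OF assms(1,2)] assms(3) by (rule ex_intermediate_vertex)
  then show ?thesis
    using assms dist_commute by (auto simp: disk_def)
qed

end

section \<open>Eccentricities\<close>

lemma ecc_le_iff:
  assumes "finite M"
  shows "ecc G M v \<le> k \<longleftrightarrow> (\<forall>u \<in> M. gdist G v u \<le> k)"
\<comment> \<open>For empty \<open>M\<close> the supremum takes its default value 0, so both sides
  hold for every \<open>k\<close>.\<close>
proof (cases "M = {}")
  case True
  then show ?thesis by (simp add: ecc_def)
next
  case False
  with assms show ?thesis
    unfolding ecc_def by (subst cSUP_le_iff) auto
qed

lemma gdist_le_ecc: "finite M \<Longrightarrow> u \<in> M \<Longrightarrow> gdist G v u \<le> ecc G M v"
  using ecc_le_iff[of M G v "ecc G M v"] by simp

lemma gdist_le_diam: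
  assumes "finite S" "u \<in> S" "v \<in> S"
  shows "gdist G u v \<le> diam G S"
  using cSUP_upper[of "(u, v)" "S \<times> S" "\<lambda>(u, v). gdist G u v"] assms
  by (simp add: diam_def bdd_above_finite)

context connected_graph
begin

lemma rad_le_ecc: "v \<in> verts G \<Longrightarrow> rad G M \<le> ecc G M v"
  by (simp add: rad_def)

lemma ex_ecc_eq_rad: "\<exists>v \<in> verts G. ecc G M v = rad G M"
proof -
  have "rad G M \<in> ecc G M ` verts G"
    unfolding rad_def using verts_nonempty by (intro Min_in) auto
  then show ?thesis by auto
qed

text \<open>Go through a vertex attaining the radius. Hence the disks of radius
  \<open>rad G M\<close> around \<open>M\<close> always meet pairwise.\<close>

lemma gdist_le_two_rad:
  assumes M: "M \<subseteq> verts G" and "u \<in> M" "v \<in> M"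
  shows "gdist G u v \<le> rad G M + rad G M"
proof -
  obtain c where c: "c \<in> verts G" "ecc G M c = rad G M"
    using ex_ecc_eq_rad by blast
  have "finite M"
    using M finite_verts by (rule finite_subset)
  then have "gdist G c u \<le> rad G M" "gdist G c v \<le> rad G M"
    using assms(2,3) gdist_le_ecc[of M _ G c] by (simp_all add: c(2))
  moreover have "gdist G u v \<le> gdist G u c + gdist G c v"
    using M assms(2,3) c(1) by (intro dist_triangle) auto
  moreover have "gdist G u c = gdist G c u"
    using M assms(2) c(1) by (intro dist_commute) auto
  ultimately show ?thesis by linarith
qed

section \<open>Weakly Helly graphs\<close>

text \<open>\<open>weakly_Helly\<close> allows only one radius per centre; several disks with a common centre
  are nested, so the smallest one stands for all of them.\<close>

lemma weakly_Helly_family: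
  assumes "weakly_Helly \<alpha> G" and P: "\<And>u a. (u, a) \<in> P \<Longrightarrow> u \<in> verts G"
    and "\<And>u v a b. (u, a) \<in> P \<Longrightarrow> (v, b) \<in> P \<Longrightarrow> gdist G u v \<le> a + b"
  obtains c where "c \<in> verts G" "\<And>u a. (u, a) \<in> P \<Longrightarrow> gdist G c u \<le> a + \<alpha>"
proof -
  define r where "r u = (LEAST a. (u, a) \<in> P)" for u
  have r: "(u, r u) \<in> P" if "u \<in> fst ` P" for u
  proof -
    obtain a where "(u, a) \<in> P"
      using \<open>u \<in> fst ` P\<close> by force
    then show ?thesis
      unfolding r_def by (rule LeastI)
  qed
  have "fst ` P \<subseteq> verts G"
    by (auto dest: P)
  moreover have "\<forall>u \<in> fst ` P. \<forall>v \<in> fst ` P. disk G u (r u) \<inter> disk G v (r v) \<noteq> {}"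
    by (intro ballI disks_intersect assms(3) P[OF r] r)
  ultimately obtain c where c: "c \<in> verts G" "\<forall>u \<in> fst ` P. c \<in> disk G u (r u + \<alpha>)"
    using \<open>weakly_Helly \<alpha> G\<close>[unfolded weakly_Helly_def, rule_format, of "fst ` P" r] by blast
  have "gdist G c u \<le> a + \<alpha>" if "(u, a) \<in> P" for u a
  proof -
    have "r u \<le> a"
      unfolding r_def using that by (rule Least_le)
    moreover have "gdist G c u \<le> r u + \<alpha>"
      using c that by (force simp: disk_def)
    ultimately show ?thesis by linarith
  qed
  with c that show ?thesis by blast
qed

lemma ex_near_center:
  assumes "weakly_Helly \<alpha> G" and M: "M \<subseteq> verts G" and x: "x \<in> verts G"
  obtains c where "c \<in> center G \<alpha> M" "gdist G x c \<le> ecc G M x - rad G M + \<alpha>"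
proof -
  let ?r = "rad G M"
  have finM: "finite M"
    using M finite_verts by (rule finite_subset)
  \<comment> \<open>Makes the truncated subtraction \<open>ecc G M x - ?r\<close> exact: adding
    \<open>?r\<close> gives back \<open>ecc G M x\<close>, which bounds the distance from
    \<open>x\<close> to \<open>M\<close>.\<close>
  have rx: "?r \<le> ecc G M x"
    using assms rad_le_ecc by blast
  have xM: "gdist G x u \<le> ecc G M x" "gdist G u x \<le> ecc G M x" if "u \<in> M" for u
    using gdist_le_ecc[OF finM that, of G x] dist_commute[OF x subsetD[OF M that]] by simp_all
  \<comment> \<open>If \<open>x\<close> lies in \<open>M\<close>, two radii may be attached to it,
    hence a set of pairs instead of a radius function.\<close>
  obtain c where c: "c \<in> verts G"
    "\<And>u a. (u, a) \<in> insert (x, ecc G M x - ?r) (M \<times> {?r}) \<Longrightarrow> gdist G c u \<le> a + \<alpha>"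
  proof (rule weakly_Helly_family[OF assms(1), of "insert (x, ecc G M x - ?r) (M \<times> {?r})"])
    fix u v a b
    assume "(u, a) \<in> insert (x, ecc G M x - ?r) (M \<times> {?r})"
      "(v, b) \<in> insert (x, ecc G M x - ?r) (M \<times> {?r})"
    then show "gdist G u v \<le> a + b"
      using xM rx gdist_le_two_rad[OF assms(2)] gdist_refl[OF assms(3)] by auto
  qed (use assms in auto)
  show ?thesis
  proof
    show "c \<in> center G \<alpha> M"
      using c finM by (simp add: center_def ecc_le_iff)
    show "gdist G x c \<le> ecc G M x - ?r + \<alpha>"
      using c assms dist_commute[of x c] by simp
  qed
qed

lemma ex_root:
  assumes "weakly_Helly \<alpha> G" and M: "M \<subseteq> verts G"
    and h: "diam G (center G \<alpha> M) \<le> 2 * h"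
  obtains c where "c \<in> verts G"
    "\<And>v. v \<in> center G \<alpha> M \<Longrightarrow> gdist G v c + ecc G M c \<le> h + rad G M + 2 * \<alpha>"
\<comment> \<open>A point of the center is only known to be within \<open>rad G M + \<alpha>\<close>
  of \<open>M\<close>, so its disk of radius \<open>h\<close> surely reaches the disks around
  \<open>M\<close> only when \<alpha> \<le> \<open>h\<close>.\<close>
proof (cases "\<alpha> \<le> h")
  case True
  let ?r = "rad G M" and ?C = "center G \<alpha> M"
  have finM: "finite M"
    using M finite_verts by (rule finite_subset)
  have C: "?C \<subseteq> verts G"
    by (auto simp: center_def)
  have dC: "gdist G u v \<le> h + h" if "u \<in> ?C" "v \<in> ?C" for u v
    using gdist_le_diam[OF finite_subset[OF C] that, of G] h by simp
  have dCM: "gdist G v u \<le> ?r + h" "gdist G u v \<le> ?r + h" if "u \<in> M" "v \<in> ?C" for u v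
  proof -
    have "gdist G v u \<le> ecc G M v" "ecc G M v \<le> ?r + \<alpha>"
      using that finM by (auto simp: center_def intro: gdist_le_ecc)
    moreover have "gdist G v u = gdist G u v"
      using that assms C by (intro dist_commute) auto
    ultimately show "gdist G v u \<le> ?r + h" "gdist G u v \<le> ?r + h"
      using True by auto
  qed
  obtain c where c: "c \<in> verts G"
    "\<And>u a. (u, a) \<in> M \<times> {?r} \<union> ?C \<times> {h} \<Longrightarrow> gdist G c u \<le> a + \<alpha>"
  proof (rule weakly_Helly_family[OF assms(1), of "M \<times> {?r} \<union> ?C \<times> {h}"])
    fix u v a b
    assume "(u, a) \<in> M \<times> {?r} \<union> ?C \<times> {h}" "(v, b) \<in> M \<times> {?r} \<union> ?C \<times> {h}"
    then show "gdist G u v \<le> a + b"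
      using dC dCM gdist_le_two_rad[OF assms(2)] by (auto simp: add.commute)
  qed (use assms C in auto)
  have "ecc G M c \<le> ?r + \<alpha>"
    using c finM by (simp add: ecc_le_iff)
  moreover have "gdist G v c \<le> h + \<alpha>" if "v \<in> ?C" for v
    using c that C dist_commute[of v c] by auto
  ultimately show ?thesis
    using that[OF c(1)] by fastforce
next
  case False
  obtain c where c: "c \<in> verts G" "ecc G M c = rad G M"
    using ex_ecc_eq_rad by blast
  \<comment> \<open>Here \<open>c\<close> is itself in the center, and the diameter is at most
    \<open>2 * h\<close>, hence below \<open>h + \<alpha>\<close>.\<close>
  have "gdist G v c \<le> diam G (center G \<alpha> M)" if "v \<in> center G \<alpha> M" for v
    using that c by (intro gdist_le_diam) (auto simp: center_def)
  then show ?thesis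
    using that[OF c(1)] c False h by fastforce
qed

section \<open>Breadth-first search trees\<close>

text \<open>Take the first arc of a shortest walk to \<open>c\<close>: the rest of the walk bounds
  the new distance from above, the triangle inequality from below.\<close>

lemma ex_parent:
  assumes "v \<in> verts G" "c \<in> verts G" "v \<noteq> c"
  shows "\<exists>w. v \<rightarrow> w \<and> gdist G v c = Suc (gdist G w c)"
proof -
  obtain p where p: "awalk v p c" "length p = gdist G v c"
    using reachable[OF assms(1,2)] by (rule shortest_awalk)
  with assms obtain e q where pe: "p = e # q"
    by (cases p) (auto simp: awalk_Nil_iff)
  with p have e: "e \<in> arcs G" "tail G e = v" and q: "awalk (head G e) q c"
    by (auto simp: awalk_Cons_iff)
  then have arc: "v \<rightarrow> head G e"
    using in_arcs_imp_in_arcs_ends by auto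
  have "awalk v [e] (head G e)"
    using e by (auto simp: awalk_simps)
  then have "gdist G v (head G e) \<le> 1"
    using gdist_le_length[of G v "[e]"] by simp
  then have "gdist G v c \<le> Suc (gdist G (head G e) c)"
    using dist_triangle[of v "head G e" c] assms e by simp
  moreover have "gdist G (head G e) c \<le> length q"
    using q by (rule gdist_le_length)
  ultimately show ?thesis
    using arc p pe by fastforce
qed

end

text \<open>At a deepest vertex of a cycle, both neighbours on the cycle are its parent, so the cycle
  has length at most 2.\<close>

lemma (in wf_digraph) no_long_cycle:
  fixes depth :: "'a \<Rightarrow> nat"
  assumes par: "\<And>e. e \<in> arcs G \<Longrightarrow>
      head G e = par (tail G e) \<and> depth (head G e) < depth (tail G e) \<or>
      tail G e = par (head G e) \<and> depth (tail G e) < depth (head G e)"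
    and "cycle p"
  shows "length p < 3"
proof (rule ccontr)
  assume "\<not> length p < 3"
  define n where "n = length p"
  have n: "n \<ge> 3"
    using \<open>\<not> length p < 3\<close> by (simp add: n_def)
  obtain u where u: "awalk u p u" "distinct (tl (awalk_verts u p))" "p \<noteq> []"
    using \<open>cycle p\<close> unfolding cycle_def by blast
  have cas: "cas u p u" and arcs: "set p \<subseteq> arcs G"
    using u by (auto simp: awalk_def)
  \<comment> \<open>After its first vertex, a walk visits exactly the heads of its arcs.\<close>
  have dist: "distinct (map (head G) p)"
    using u(2,3) by (simp add: awalk_verts_conv'[OF cas])
  have verts_eq: "map (tail G) p @ [head G (last p)] = tail G (hd p) # map (head G) p"
    using awalk_verts_conv'[OF cas] awalk_verts_conv[of u p] u(3) by simp
  have ends: "tail G (hd p) = head G (last p)"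
    using awhd_of_awalk[OF u(1)] awlast_of_awalk[OF u(1)] u(3)
    by (simp add: awalk_verts_conv hd_append hd_map)
  \<comment> \<open>Cyclic indexing: the last arc is followed by the first.\<close>
  have succ: "tail G (p ! (Suc i mod n)) = head G (p ! i)" if "i < n" for i
  proof (cases "Suc i = n")
    case True
    then show ?thesis
      using ends u(3) by (simp add: hd_conv_nth last_conv_nth flip: True n_def)
  next
    case False
    with that have "Suc i < n" by simp
    then have "(map (tail G) p @ [head G (last p)]) ! Suc i = tail G (p ! Suc i)"
      by (simp add: nth_append n_def)
    moreover have "(tail G (hd p) # map (head G) p) ! Suc i = head G (p ! i)"
      using that by (simp add: n_def)
    ultimately show ?thesis
      using verts_eq \<open>Suc i < n\<close> by simp
  qed
  let ?d = "\<lambda>i. depth (head G (p ! i))"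
  obtain j where j: "j < n" and max: "\<And>i. i < n \<Longrightarrow> ?d i \<le> ?d j"
  proof -
    have "Max (?d ` {..<n}) \<in> ?d ` {..<n}"
      using n by (intro Max_in) (auto simp: lessThan_empty_iff)
    then obtain j where "j < n" "?d j = Max (?d ` {..<n})"
      by auto
    then show ?thesis
      using that[of j] by simp
  qed
  \<comment> \<open>Cyclic predecessor and successor of \<open>j\<close>; adding
    \<open>n - 1\<close> avoids truncation at \<open>j = 0\<close>. They differ because
    \<open>n\<close> is at least 3; for \<open>n = 2\<close> they would coincide.\<close>
  define k where "k = (j + (n - 1)) mod n"
  define l where "l = Suc j mod n"
  have k: "k < n" "Suc k mod n = j" and l: "l < n"
    using j n by (auto simp: k_def l_def mod_Suc_eq)
  have "k \<noteq> l"
    using j n by (auto simp: k_def l_def mod_if split: if_splits)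
  have arc: "p ! i \<in> arcs G" if "i < n" for i
    using that arcs by (auto simp: n_def)
  \<comment> \<open>Arc \<open>j\<close> enters the deepest vertex and arc \<open>l\<close> leaves
    it. Maximal depth rules out that this vertex is the parent end of either arc.\<close>
  have "tail G (p ! j) = head G (p ! k)"
    using succ[OF k(1)] k(2) by simp
  then have "head G (p ! k) = par (head G (p ! j))"
    using par[OF arc[OF j]] max[OF k(1)] by auto
  moreover have "head G (p ! l) = par (head G (p ! j))"
    using par[OF arc[OF l]] max[OF l] succ[OF j] unfolding l_def by auto
  ultimately have "map (head G) p ! k = map (head G) p ! l"
    using k l by (simp add: n_def)
  then show False
    using nth_eq_iff_index_eq[OF dist, of k l] k(1) l \<open>k \<noteq> l\<close> by (simp add: n_def)
qed

lemma (in connected_graph) ex_bfs_tree: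
  assumes c: "c \<in> verts G"
  obtains T where "undirected_spanning_tree T G" "\<And>v. v \<in> verts G \<Longrightarrow> gdist T v c \<le> gdist G v c"
proof -
  obtain par where par: "\<And>v. v \<in> verts G \<Longrightarrow> v \<noteq> c \<Longrightarrow>
      v \<rightarrow> par v \<and> gdist G v c = Suc (gdist G (par v) c)"
    using ex_parent[OF _ c] by metis
  \<comment> \<open>Both orientations of each parent edge are kept, for symmetry. The root is
    excluded as a child because \<open>par c\<close> is arbitrary.\<close>
  define E where "E = {e \<in> arcs G. tail G e \<noteq> c \<and> head G e = par (tail G e) \<or>
      head G e \<noteq> c \<and> tail G e = par (head G e)}"
  define T where "T = G\<lparr>arcs := E\<rparr>"
  have T_simps [simp]: "verts T = verts G" "arcs T = E" "tail T = tail G" "head T = head G"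
    by (simp_all add: T_def)
  have E_arcs: "E \<subseteq> arcs G"
    by (auto simp: E_def)
  have "symmetric T"
    unfolding symmetric_conv
  proof
    fix e assume e: "e \<in> arcs T"
    then obtain e' where "e' \<in> arcs G" "tail G e = head G e'" "head G e = tail G e'"
      using sym_arcs E_arcs unfolding symmetric_conv by (metis T_simps(2) subsetD)
    with e show "\<exists>e' \<in> arcs T. tail T e = head T e' \<and> head T e = tail T e'"
      by (auto simp: E_def intro!: bexI[of _ e'])
  qed
  moreover have "e1 = e2"
    if "e1 \<in> E" "e2 \<in> E" "arc_to_ends T e1 = arc_to_ends T e2" for e1 e2
    using that E_arcs no_multi_arcs by (auto simp: arc_to_ends_def)
  ultimately interpret T: graph T
    using E_arcs finite_subset[OF E_arcs] no_loops by unfold_locales auto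
  \<comment> \<open>Each step to the parent costs one arc in \<open>T\<close> and lowers the
    distance to \<open>c\<close> in \<open>G\<close> by one.\<close>
  have to_root: "v \<rightarrow>\<^sup>*\<^bsub>T\<^esub> c \<and> gdist T v c \<le> gdist G v c" if "v \<in> verts G" for v
    using that
  proof (induction "gdist G v c" arbitrary: v rule: less_induct)
    case less
    show ?case
    proof (cases "v = c")
      case True
      then show ?thesis
        using c T.gdist_refl[of c] by simp
    next
      case False
      then have p: "v \<rightarrow> par v" "gdist G v c = Suc (gdist G (par v) c)"
        using par less.prems by auto
      then have "par v \<in> verts G"
        using adj_in_verts by blast
      with p less.hyps have IH: "par v \<rightarrow>\<^sup>*\<^bsub>T\<^esub> c" "gdist T (par v) c \<le> gdist G (par v) c"
        by auto
      obtain e where "e \<in> arcs G" "tail G e = v" "head G e = par v"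
        using p(1) by (auto simp: arcs_ends_conv)
      then have "T.awalk v [e] (par v)"
        using False \<open>par v \<in> verts G\<close> by (auto simp: T.awalk_simps E_def)
      then have "v \<rightarrow>\<^sup>*\<^bsub>T\<^esub> par v" "gdist T v (par v) \<le> 1"
        using gdist_le_length[of T v "[e]"] by (auto intro: T.reachable_awalkI)
      then show ?thesis
        using IH p T.gdist_triangle[of v "par v" c] T.reachable_trans by fastforce
    qed
  qed
  have "Digraph_Component.connected T"
  proof (rule T.connectedI)
    show "u \<rightarrow>\<^sup>*\<^bsub>mk_symmetric T\<^esub> v" if "u \<in> verts T" "v \<in> verts T" for u v
      using that to_root T.symmetric_reachable' T.reachable_trans T.reachable_mk_symmetricI
      by (metis T_simps(1))
  qed (use c in auto)
  \<comment> \<open>Depth is measured in \<open>G\<close>, where \<open>par\<close> is known to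
    lower it.\<close>
  moreover have "length p < 3" if "T.cycle p" for p
  proof (rule T.no_long_cycle[OF _ that, of par "\<lambda>v. gdist G v c"])
    fix e assume "e \<in> arcs T"
    then show "head T e = par (tail T e) \<and> gdist G (head T e) c < gdist G (tail T e) c \<or>
      tail T e = par (head T e) \<and> gdist G (tail T e) c < gdist G (head T e) c"
      using par E_arcs by (auto simp: E_def)
  qed
  ultimately have "undirected_tree T"
    unfolding undirected_tree_def using T.graph_axioms by (meson leD)
  moreover have "spanning T G"
    using E_arcs wf_digraph T.wf_digraph
    by (auto simp: spanning_def subgraph_def compatible_def)
  ultimately show ?thesis
    using to_root that by (auto simp: undirected_spanning_tree_def)
qed

section \<open>Tree eccentricities and the final bound\<close>

lemma (in connected_graph) ex_spanning_tree_ecc: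
  assumes c: "c \<in> verts G" and M: "M \<subseteq> verts G"
  obtains T where "undirected_spanning_tree T G"
    "\<And>x. x \<in> verts G \<Longrightarrow> ecc T M x \<le> gdist G x c + ecc G M c"
proof -
  obtain T where T: "undirected_spanning_tree T G"
    "\<And>v. v \<in> verts G \<Longrightarrow> gdist T v c \<le> gdist G v c"
    using ex_bfs_tree[OF c] by blast
  interpret T: connected_graph T
    using T(1)
    by (simp add: undirected_spanning_tree_def undirected_tree_def connected_graph_def
      connected_graph_axioms_def)
  have vT: "verts T = verts G"
    using T(1) by (simp add: undirected_spanning_tree_def spanning_def)
  have finM: "finite M"
    using M finite_verts by (rule finite_subset)
  have "ecc T M x \<le> gdist G x c + ecc G M c" if x: "x \<in> verts G" for x
    unfolding ecc_le_iff[OF finM]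
  proof
    fix u assume u: "u \<in> M"
    with M have uG: "u \<in> verts G" by auto
    \<comment> \<open>Routing through the root leaves only distances to \<open>c\<close>, which the
      tree does not increase.\<close>
    have "gdist T x u \<le> gdist T x c + gdist T u c"
      using T.dist_triangle[of x c u] T.dist_commute[of u c] x uG c vT by simp
    also have "\<dots> \<le> gdist G x c + gdist G c u"
      using T(2)[OF x] T(2)[OF uG] dist_commute[OF uG c] by simp
    also have "gdist G c u \<le> ecc G M c"
      using finM u by (rule gdist_le_ecc)
    finally show "gdist T x u \<le> gdist G x c + ecc G M c" by simp
  qed
  with T(1) that show ?thesis by blast
qed

theorem theorem7:
  fixes G :: "('a, 'b) pre_digraph" and \<alpha> :: nat
  assumes "graph G"
    and "Digraph_Component.connected G"
    and "weakly_Helly \<alpha> G"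
  shows "\<forall>M. M \<subseteq> verts G \<longrightarrow>
    (\<exists>T. undirected_spanning_tree T G \<and>
      (\<forall>x \<in> verts G.
        int (ecc T M x) - int (ecc G M x)
          \<le> \<lceil>real (diam G (center G \<alpha> M)) / 2\<rceil> + 3 * int \<alpha>))"
proof (intro allI impI)
  fix M assume M: "M \<subseteq> verts G"
  interpret connected_graph G
    using assms by (simp add: connected_graph_def connected_graph_axioms_def)
  define h where "h = nat \<lceil>real (diam G (center G \<alpha> M)) / 2\<rceil>"
  \<comment> \<open>The ceiling is nonnegative, so \<open>nat\<close> loses nothing.\<close>
  have h: "\<lceil>real (diam G (center G \<alpha> M)) / 2\<rceil> = int h"
    unfolding h_def by (simp add: order_less_le_trans[of "- 1" 0])
  then have "diam G (center G \<alpha> M) \<le> 2 * h"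
    by linarith
  then obtain c where c: "c \<in> verts G"
    "\<And>v. v \<in> center G \<alpha> M \<Longrightarrow> gdist G v c + ecc G M c \<le> h + rad G M + 2 * \<alpha>"
    using ex_root[OF assms(3) M] by blast
  obtain T where T: "undirected_spanning_tree T G"
    "\<And>x. x \<in> verts G \<Longrightarrow> ecc T M x \<le> gdist G x c + ecc G M c"
    using ex_spanning_tree_ecc[OF c(1) M] by blast
  \<comment> \<open>Reaching the center costs \<open>ecc G M x - rad G M + \<alpha>\<close>, and
    going on through the root \<open>h + rad G M + 2 * \<alpha>\<close>; the radius cancels since it
    is at most \<open>ecc G M x\<close>.\<close>
  have "ecc T M x \<le> ecc G M x + h + 3 * \<alpha>" if x: "x \<in> verts G" for x
  proof -
    obtain v where v: "v \<in> center G \<alpha> M" "gdist G x v \<le> ecc G M x - rad G M + \<alpha>"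
      using ex_near_center[OF assms(3) M x] by blast
    then have "gdist G x c \<le> gdist G x v + gdist G v c"
      using x c(1) by (intro dist_triangle) (auto simp: center_def)
    then show ?thesis
      using T(2)[OF x] v(2) c(2)[OF v(1)] rad_le_ecc[OF x, of M] by linarith
  qed
  then show "\<exists>T. undirected_spanning_tree T G \<and>
      (\<forall>x \<in> verts G. int (ecc T M x) - int (ecc G M x)
        \<le> \<lceil>real (diam G (center G \<alpha> M)) / 2\<rceil> + 3 * int \<alpha>)"
    using T(1) unfolding h by (intro exI[of _ T]) force
qed

end
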